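(* Let $m\ge 1$ and let $p_1,\dots,p_m$ be probability distributions on $\mathrm{U}(1)$, each symmetric and with zero mean. Let $\mathbf{A}=\mathbf{Q}_1\boldsymbol{\Lambda}^{(1)}$ and $\mathbf{B}=\mathbf{Q}_2\boldsymbol{\Lambda}^{(2)}$ be independent random matrices such that, for $i=1,2$, $\mathbf{Q}_i\in\mathbb{C}^{m\times m}$ is a random unitary matrix and, independently of $\mathbf{Q}_i$, $\boldsymbol{\Lambda}^{(i)}=\operatorname{diag}(\Lambda^{(i)}_1,\dots,\Lambda^{(i)}_m)$ is a random diagonal matrix with $\Lambda^{(i)}_j\sim p_j$ for $j=1,\dots,m$; the pairs $(\mathbf{Q}_1,\boldsymbol{\Lambda}^{(1)})$ and $(\mathbf{Q}_2,\boldsymbol{\Lambda}^{(2)})$ are sampled independently of each other. Then $\mathbb{E}\,\operatorname{tr}(\mathbf{A}\mathbf{B}^{\dagger})=0$.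
   Context: $\mathrm{U}(1)=\{z\in\mathbb{C}:|z|=1\}$. A distribution $p$ on $\mathrm{U}(1)$ is symmetric if $X\sim p$ implies $-X\sim p$, and has zero mean if $\mathbb{E}[X]=0$ for $X\sim p$. For a complex matrix $\mathbf{M}$, $\mathbf{M}^{\dagger}$ denotes the conjugate transpose, and $\operatorname{tr}$ is the trace. A matrix $\mathbf{Q}\in\mathbb{C}^{m\times m}$ is unitary if $\mathbf{Q}\mathbf{Q}^{\dagger}=\mathbf{I}$. *)

theory Defs
  imports "HOL-Probability.Probability"
begin

definition U1 :: "complex set" where
  "U1 = {z. cmod z = 1}"

definition distribution_on_U1 :: "complex measure \<Rightarrow> bool" where
  "distribution_on_U1 p \<longleftrightarrow> prob_space p \<and> sets p = sets (restrict_space borel U1)"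

text \<open>\<open>X \<sim> p\<close> for a random variable \<open>X\<close> on \<open>M\<close>. Taking the measurable space of \<open>p\<close> as
  codomain makes \<open>X\<close> take values in \<^term>\<open>space p\<close>, which is \<^const>\<open>U1\<close> for a distribution on \<^const>\<open>U1\<close>.\<close>

definition has_law :: "'w measure \<Rightarrow> ('w \<Rightarrow> 'a) \<Rightarrow> 'a measure \<Rightarrow> bool" where
  "has_law M X p \<longleftrightarrow> X \<in> measurable M p \<and> distr M p X = p"

text \<open>The condition ``\<open>X \<sim> p\<close> implies \<open>-X \<sim> p\<close>'' is a property of \<open>p\<close> alone: it says that the
  push-forward of \<open>p\<close> under negation is \<open>p\<close>. Similarly, the mean of any \<open>X \<sim> p\<close> is the integral of
  the identity with respect to \<open>p\<close>, which exists since \<^const>\<open>U1\<close> is bounded.\<close>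

definition symmetric_distribution :: "complex measure \<Rightarrow> bool" where
  "symmetric_distribution p \<longleftrightarrow> has_law p uminus p"

definition zero_mean :: "complex measure \<Rightarrow> bool" where
  "zero_mean p \<longleftrightarrow> (\<integral>z. z \<partial>p) = 0"

definition conj_transpose :: "complex ^ 'n ^ 'm \<Rightarrow> complex ^ 'm ^ 'n" where
  "conj_transpose A = (\<chi> i j. cnj (A $ j $ i))"

definition unitary_matrix :: "complex ^ 'm ^ 'm \<Rightarrow> bool" where
  "unitary_matrix Q \<longleftrightarrow> Q ** conj_transpose Q = mat 1"

definition diag_matrix :: "complex ^ 'm \<Rightarrow> complex ^ 'm ^ 'm" where
  "diag_matrix v = (\<chi> i j. if i = j then v $ i else 0)"

end

theory Submission
  imports Defs
begin

text \<open>Entrywise, \<open>tr (A B\<^sup>\<dagger>)\<close> is the sum of all \<open>A\<^sub>i\<^sub>j * cnj B\<^sub>i\<^sub>j\<close>. Independence of the two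
  pairs factors each expectation into \<open>E A\<^sub>i\<^sub>j\<close> and \<open>cnj (E B\<^sub>i\<^sub>j)\<close>, and independence within a pair
  gives \<open>E A\<^sub>i\<^sub>j = E (Q\<^sub>1)\<^sub>i\<^sub>j * E \<Lambda>\<^sub>j = 0\<close>. Integrability holds because all entries are bounded by 1.\<close>

lemma trace_mult_conj_transpose:
  fixes A B :: "complex ^ 'n ^ 'm"
  shows "trace (A ** conj_transpose B) = (\<Sum>i\<in>UNIV. \<Sum>j\<in>UNIV. A $ i $ j * cnj (B $ i $ j))"
  by (simp add: trace_def matrix_matrix_mult_def conj_transpose_def)

lemma mult_diag_matrix_entry: "(Q ** diag_matrix v) $ i $ j = Q $ i $ j * v $ j"
  by (simp add: matrix_matrix_mult_def diag_matrix_def if_distrib[of "(*) _"] cong: if_cong)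

text \<open>The diagonal entries of \<open>Q ** conj_transpose Q\<close> are the squared norms of
  the rows of \<open>Q\<close>. So every row is a unit vector, and none of its coordinates can
  exceed 1 in modulus.\<close>

lemma unitary_matrix_entry_le_1:
  assumes "unitary_matrix Q"
  shows "cmod (Q $ i $ j) \<le> 1"
proof -
  have "(Q ** conj_transpose Q) $ i $ i = 1"
    using assms by (simp add: unitary_matrix_def mat_def)
  then have "complex_of_real (\<Sum>k\<in>UNIV. (cmod (Q $ i $ k))\<^sup>2) = 1"
    by (simp add: matrix_matrix_mult_def conj_transpose_def flip: complex_norm_square)
  then have "(\<Sum>k\<in>UNIV. (cmod (Q $ i $ k))\<^sup>2) = 1"
    using of_real_eq_1_iff by blast
  moreover have "(cmod (Q $ i $ j))\<^sup>2 \<le> (\<Sum>k\<in>UNIV. (cmod (Q $ i $ k))\<^sup>2)"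
    by (rule member_le_sum) auto
  ultimately show ?thesis
    by (simp add: abs_square_le_1)
qed

lemma borel_measurable_matrix_entry:
  "(\<lambda>X :: complex ^ 'n ^ 'm. X $ i $ j) \<in> borel_measurable borel"
  by (intro borel_measurable_continuous_onI continuous_intros)

text \<open>Transfers what is known of \<open>p\<close>, a measure living on \<open>U1\<close> only,
  to \<open>X\<close> seen as an ordinary complex random variable on \<open>M\<close>.\<close>

lemma has_law_U1:
  assumes p: "distribution_on_U1 p" and X: "has_law M X p"
  shows has_law_U1_measurable: "X \<in> borel_measurable M"
    and has_law_U1_norm: "\<omega> \<in> space M \<Longrightarrow> cmod (X \<omega>) = 1"
    and has_law_U1_expectation: "zero_mean p \<Longrightarrow> (\<integral>\<omega>. X \<omega> \<partial>M) = 0"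
proof -
  have sets: "sets p = sets (restrict_space borel U1)"
    using p by (simp add: distribution_on_U1_def)
  have meas: "X \<in> measurable M p" and distr: "distr M p X = p"
    using X by (auto simp: has_law_def)
  \<comment> \<open>The inclusion of \<open>U1\<close> into the complex plane is measurable.
    Composing with it makes \<open>X\<close> Borel, and it is the integrand in the change of
    variables that turns the mean of \<open>X\<close> into the mean of \<open>p\<close>.\<close>
  have id: "(\<lambda>z. z) \<in> borel_measurable p"
    unfolding measurable_cong_sets[OF sets refl] by (rule measurable_restrict_space1) simp
  show "X \<in> borel_measurable M"
    using measurable_compose[OF meas id] .
  show "cmod (X \<omega>) = 1" if "\<omega> \<in> space M"
    using measurable_space[OF meas that] sets_eq_imp_space_eq[OF sets]
    by (simp add: space_restrict_space U1_def)
  show "(\<integral>\<omega>. X \<omega> \<partial>M) = 0" if "zero_mean p"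
    using integral_distr[OF meas id] that by (simp add: distr zero_mean_def)
qed

text \<open>Right multiplication by a diagonal matrix scales columns, so the entry is a product of
  two bounded independent factors, the second a centred phase. Used once for each of the two
  pairs.\<close>

lemma (in prob_space) unitary_times_phases_entry:
  fixes Q :: "'a \<Rightarrow> complex ^ 'm ^ 'm" and lam :: "'a \<Rightarrow> complex ^ 'm"
  assumes Q: "Q \<in> borel_measurable M"
    and unitary: "\<And>\<omega>. \<omega> \<in> space M \<Longrightarrow> unitary_matrix (Q \<omega>)"
    and p: "distribution_on_U1 p" "zero_mean p"
    and law: "has_law M (\<lambda>\<omega>. lam \<omega> $ j) p"
    and indep: "indep_var borel Q borel (\<lambda>\<omega>. diag_matrix (lam \<omega>))"
  shows unitary_times_phases_entry_integrable:
      "integrable M (\<lambda>\<omega>. (Q \<omega> ** diag_matrix (lam \<omega>)) $ i $ j)"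
    and unitary_times_phases_entry_expectation:
      "expectation (\<lambda>\<omega>. (Q \<omega> ** diag_matrix (lam \<omega>)) $ i $ j) = 0"
proof -
  note lam = has_law_U1[OF p(1) law]
  have Q_int: "integrable M (\<lambda>\<omega>. Q \<omega> $ i $ j)"
    using measurable_compose[OF Q borel_measurable_matrix_entry] unitary
    by (intro integrable_const_bound[where B = 1] AE_I2) (auto intro: unitary_matrix_entry_le_1)
  have lam_int: "integrable M (\<lambda>\<omega>. lam \<omega> $ j)"
    using lam(1,2) by (intro integrable_const_bound[where B = 1] AE_I2) auto
  \<comment> \<open>Independence is assumed for the whole diagonal matrix; the phase is recovered
    from it as the entry at position \<open>(j, j)\<close>.\<close>
  have indep_entry: "indep_var borel (\<lambda>\<omega>. Q \<omega> $ i $ j) borel (\<lambda>\<omega>. lam \<omega> $ j)"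
    using indep_var_compose[OF indep borel_measurable_matrix_entry[of i j]
        borel_measurable_matrix_entry[of j j]]
    by (simp add: o_def diag_matrix_def)
  show "integrable M (\<lambda>\<omega>. (Q \<omega> ** diag_matrix (lam \<omega>)) $ i $ j)"
    using indep_var_integrable[OF indep_entry Q_int lam_int]
    by (simp add: mult_diag_matrix_entry)
  show "expectation (\<lambda>\<omega>. (Q \<omega> ** diag_matrix (lam \<omega>)) $ i $ j) = 0"
    using indep_var_lebesgue_integral[OF indep_entry Q_int lam_int] lam(3)[OF p(2)]
    by (simp add: mult_diag_matrix_entry)
qed

text \<open>By \<open>borel_prod\<close> the product sigma-algebra is the Borel one of the product
  space, so continuity of the entry, a polynomial in those of the factors, suffices.\<close>

lemma borel_measurable_matrix_mult_entry:
  "(\<lambda>(X :: complex ^ 'n ^ 'm, Y :: complex ^ 'k ^ 'n). (X ** Y) $ i $ j)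
     \<in> borel_measurable (borel \<Otimes>\<^sub>M borel)"
  unfolding borel_prod matrix_matrix_mult_def split_def
  by (intro borel_measurable_continuous_onI) (simp, intro continuous_intros)

theorem corollary2:
  fixes M :: "'w measure"
    and p :: "'m::finite \<Rightarrow> complex measure"
    and Q1 Q2 :: "'w \<Rightarrow> complex ^ 'm ^ 'm"
    and lam1 lam2 :: "'w \<Rightarrow> complex ^ 'm"
    and \<Lambda>1 \<Lambda>2 A B :: "'w \<Rightarrow> complex ^ 'm ^ 'm"
  assumes M: "prob_space M"
    and p_distribution: "\<And>j. distribution_on_U1 (p j)"
    and p_symmetric: "\<And>j. symmetric_distribution (p j)"
    and p_zero_mean: "\<And>j. zero_mean (p j)"
    and Q1_measurable: "Q1 \<in> borel_measurable M"
    and Q2_measurable: "Q2 \<in> borel_measurable M"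
    and Q1_unitary: "\<And>\<omega>. \<omega> \<in> space M \<Longrightarrow> unitary_matrix (Q1 \<omega>)"
    and Q2_unitary: "\<And>\<omega>. \<omega> \<in> space M \<Longrightarrow> unitary_matrix (Q2 \<omega>)"
    and \<Lambda>1: "\<Lambda>1 = (\<lambda>\<omega>. diag_matrix (lam1 \<omega>))"
    and \<Lambda>2: "\<Lambda>2 = (\<lambda>\<omega>. diag_matrix (lam2 \<omega>))"
    and lam1_law: "\<And>j. has_law M (\<lambda>\<omega>. lam1 \<omega> $ j) (p j)"
    and lam2_law: "\<And>j. has_law M (\<lambda>\<omega>. lam2 \<omega> $ j) (p j)"
    and indep1: "prob_space.indep_var M borel Q1 borel \<Lambda>1"
    and indep2: "prob_space.indep_var M borel Q2 borel \<Lambda>2"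
    and indep_pairs: "prob_space.indep_var M
           (borel \<Otimes>\<^sub>M borel) (\<lambda>\<omega>. (Q1 \<omega>, \<Lambda>1 \<omega>))
           (borel \<Otimes>\<^sub>M borel) (\<lambda>\<omega>. (Q2 \<omega>, \<Lambda>2 \<omega>))"
    and A: "A = (\<lambda>\<omega>. Q1 \<omega> ** \<Lambda>1 \<omega>)"
    and B: "B = (\<lambda>\<omega>. Q2 \<omega> ** \<Lambda>2 \<omega>)"
  shows "integrable M (\<lambda>\<omega>. trace (A \<omega> ** conj_transpose (B \<omega>))) \<and>
         prob_space.expectation M (\<lambda>\<omega>. trace (A \<omega> ** conj_transpose (B \<omega>))) = 0"
proof -
  interpret prob_space M by (rule M)
  have A_entry: "integrable M (\<lambda>\<omega>. A \<omega> $ i $ j)" "expectation (\<lambda>\<omega>. A \<omega> $ i $ j) = 0" for i j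
    unfolding A \<Lambda>1
    using unitary_times_phases_entry[OF Q1_measurable Q1_unitary p_distribution p_zero_mean
        lam1_law indep1[unfolded \<Lambda>1]]
    by auto
  have B_entry: "integrable M (\<lambda>\<omega>. B \<omega> $ i $ j)" "expectation (\<lambda>\<omega>. B \<omega> $ i $ j) = 0" for i j
    unfolding B \<Lambda>2
    using unitary_times_phases_entry[OF Q2_measurable Q2_unitary p_distribution p_zero_mean
        lam2_law indep2[unfolded \<Lambda>2]]
    by auto
  have cnj_B: "integrable M (\<lambda>\<omega>. cnj (B \<omega> $ i $ j))" for i j
    using B_entry(1) by simp
  \<comment> \<open>Each side is a Borel function of one pair only, so independence of the pairs
    passes to the entries.\<close>
  have indep: "indep_var borel (\<lambda>\<omega>. A \<omega> $ i $ j) borel (\<lambda>\<omega>. cnj (B \<omega> $ i $ j))" for i j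
  proof -
    have cnj: "cnj \<in> borel_measurable borel"
      by (intro borel_measurable_continuous_onI continuous_intros)
    show ?thesis
      using indep_var_compose[OF indep_pairs borel_measurable_matrix_mult_entry[of i j]
          measurable_compose[OF borel_measurable_matrix_mult_entry[of i j] cnj]]
      by (simp add: o_def A B)
  qed
  have "integrable M (\<lambda>\<omega>. A \<omega> $ i $ j * cnj (B \<omega> $ i $ j))" for i j
    by (rule indep_var_integrable[OF indep A_entry(1) cnj_B])
  \<comment> \<open>The expectation factors, and the factor coming from \<open>A\<close>
    vanishes.\<close>
  moreover have "expectation (\<lambda>\<omega>. A \<omega> $ i $ j * cnj (B \<omega> $ i $ j)) = 0" for i j
    using indep_var_lebesgue_integral[OF indep A_entry(1) cnj_B] A_entry(2) by simp
  ultimately show ?thesis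
    by (simp add: trace_mult_conj_transpose)
qed

end
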